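(* Let $\alpha>-1$, $\beta>0$ and let $n$ be a positive integer with $n>\beta$. For integers $r\ge 0$ write $\mu_r^{(\alpha,\beta)}(x)=M_n^{(\alpha,\beta)}[t^r](x)$. Then for every integer $r\ge 1$ and every $x\ge 0$, $$\frac{d}{dx}\,\mu_r^{(\alpha,\beta)}(x)=\frac{n r}{n-\beta}\;\mu_{r-1}^{(\alpha+1,\beta)}(x),$$ where on the right-hand side the moment is the one of the operator $M_n^{(\alpha+1,\beta)}$, i.e. with the parameter $\alpha$ replaced by $\alpha+1$ (and the same $n$ and $\beta$).
   Context: For $k=0,1,2,\dots$ and $x\ge 0$ put $\psi_{n,k}(x)=\dfrac{(nx)^k e^{-nx}}{k!}$. The operator $M_n^{(\alpha,\beta)}$ is $$M_n^{(\alpha,\beta)}[f](x)=\sum_{k=0}^{\infty}\left(\frac{(n-\beta)^{k+\alpha+1}}{\Gamma(k+\alpha+1)}\int_0^\infty f(t)\,t^{k+\alpha}e^{-(n-\beta)t}\,dt\right)\psi_{n,k}(x),\qquad x\ge 0.$$ $M_n^{(\alpha,\beta)}[t^r]$ denotes the operator applied to the function $t\mapsto t^r$. *)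

theory Defs
  imports "HOL-Analysis.Analysis"
begin

definition psi :: "nat \<Rightarrow> nat \<Rightarrow> real \<Rightarrow> real" where
  "psi n k x = (real n * x) ^ k * exp (- (real n * x)) / fact k"

text \<open>
  The integral is the Lebesgue integral. For \<open>k = 0\<close> and \<open>\<alpha> < 0\<close> the weight is singular at
  \<open>t = 0\<close>, where \<open>powr\<close> takes the value 0; a single point does not affect the integral.
  Integral and series have their intended meaning when they converge, which is the case for
  \<open>f = (\<lambda>t. t ^ r)\<close>, \<open>\<alpha> > -1\<close> and \<open>n > \<beta>\<close>.
\<close>

definition M_op :: "real \<Rightarrow> real \<Rightarrow> nat \<Rightarrow> (real \<Rightarrow> real) \<Rightarrow> real \<Rightarrow> real" where
  "M_op \<alpha> \<beta> n f x =
     (\<Sum>k. ((real n - \<beta>) powr (real k + \<alpha> + 1) / Gamma (real k + \<alpha> + 1)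
             * (LBINT t:{0..}. f t * t powr (real k + \<alpha>) * exp (- ((real n - \<beta>) * t))))
           * psi n k x)"

definition moment :: "real \<Rightarrow> real \<Rightarrow> nat \<Rightarrow> nat \<Rightarrow> real \<Rightarrow> real" where
  "moment \<alpha> \<beta> n r = M_op \<alpha> \<beta> n (\<lambda>t. t ^ r)"

end

(* By the Euler integral the r-th moment is
   \<mu>_r(x) = (n - \<beta>)^(-r) \<Sum>_k (k + \<alpha> + 1)_r \<psi>_{n,k}(x)
   with rising factorials (Pochhammer symbols).  Differentiating an expansion
   \<Sum>_k a_k \<psi>_{n,k}(x) replaces a_k by n (a_{k+1} - a_k), and the forward difference of the
   rising factorial is (z + 1)_r - (z)_r = r (z + 1)_{r-1}. *)
theory Submission
  imports Defs
begin

text \<open>Euler's integral for \<open>Gamma s\<close> after the substitution replacing t by c * t,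
  which produces the factor \<open>c powr s\<close>.\<close>

lemma set_integral_powr_exp:
  fixes s c :: real
  assumes "s > 0" "c > 0"
  shows "(LBINT t:{0..}. t powr (s - 1) * exp (- (c * t))) = Gamma s / c powr s"
proof -
  define g :: "real \<Rightarrow> real" where "g = (\<lambda>t. indicator {0..} t * t powr (s - 1) / exp t)"
  \<comment> \<open>\<open>g\<close> is nonnegative and measurable, so its Lebesgue integral can be
    read off from the nonnegative-integral form of Euler's formula without a separate integrability
    argument.\<close>
  have "integral\<^sup>L lborel g = enn2real (integral\<^sup>N lborel (\<lambda>t. ennreal (g t)))"
    by (rule integral_eq_nn_integral) (auto simp: g_def)
  also have "\<dots> = Gamma s"
    using assms by (simp add: g_def flip: Gamma_conv_nn_integral_real)
  finally have "Gamma s = integral\<^sup>L lborel g" ..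
  also have "\<dots> = c * (LBINT t. g (c * t))"
    using lborel_integral_real_affine[of c g 0] assms by simp
  also have "(\<lambda>t. g (c * t)) =
      (\<lambda>t. c powr (s - 1) * (indicator {0..} t * (t powr (s - 1) * exp (- (c * t)))))"
    using assms
    by (auto simp: fun_eq_iff g_def indicator_def zero_le_mult_iff powr_mult exp_minus field_simps)
  also have "c * (LBINT t. c powr (s - 1) * (indicator {0..} t * (t powr (s - 1) * exp (- (c * t))))) =
      c powr s * (LBINT t:{0..}. t powr (s - 1) * exp (- (c * t)))"
    using assms by (simp add: set_lebesgue_integral_def powr_diff[of c])
  finally show ?thesis
    using assms by (simp add: field_simps)
qed

text \<open>The two series agree term by term, so convergence is not at issue: with s = k + \<alpha>
  + 1 each coefficient is Gamma (s + r) / Gamma s divided by (n - \<beta>)^r.\<close>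

lemma moment_eq_pochhammer_series:
  assumes "\<alpha> > -1" "real n > \<beta>"
  shows "moment \<alpha> \<beta> n r x =
    (\<Sum>k. pochhammer (real k + \<alpha> + 1) r / (real n - \<beta>) ^ r * psi n k x)"
  unfolding moment_def M_op_def
proof (intro arg_cong[where f = suminf] ext arg_cong2[where f = "(*)"] refl)
  fix k
  define c where "c = real n - \<beta>"
  define s where "s = real k + \<alpha> + 1"
  have c: "c > 0" and s: "s > 0"
    using assms by (auto simp: c_def s_def)
  \<comment> \<open>At t = 0 both sides vanish because \<open>0 powr _ = 0\<close>, even for r = 0;
    for t > 0 the exponents add up to the form that Euler's integral expects.\<close>
  have *: "t ^ r * t powr (real k + \<alpha>) = t powr (s + real r - 1)" if "t \<ge> 0" for t
  proof (cases "t = 0")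
    case False
    with that have "t ^ r * t powr (real k + \<alpha>) = t powr (real r + (real k + \<alpha>))"
      by (simp add: powr_add powr_realpow)
    then show ?thesis
      by (simp add: s_def algebra_simps)
  qed auto
  have "(LBINT t:{0..}. t ^ r * t powr (real k + \<alpha>) * exp (- (c * t))) =
      (LBINT t:{0..}. t powr (s + real r - 1) * exp (- (c * t)))"
    by (rule set_lebesgue_integral_cong) (auto simp: *)
  also have "\<dots> = Gamma (s + real r) / c powr (s + real r)"
    using c s by (intro set_integral_powr_exp) auto
  finally have int: "(LBINT t:{0..}. t ^ r * t powr (real k + \<alpha>) * exp (- (c * t))) =
      Gamma (s + real r) / (c powr s * c ^ r)"
    using c by (simp add: powr_add powr_realpow)
  have "s \<notin> \<int>\<^sub>\<le>\<^sub>0"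
    using s by (auto elim!: nonpos_Ints_cases)
  then have poch: "pochhammer s r = Gamma (s + real r) / Gamma s"
    by (rule pochhammer_Gamma)
  have "c powr s / Gamma s * (Gamma (s + real r) / (c powr s * c ^ r)) = pochhammer s r / c ^ r"
    using c by (simp add: poch)
  then show "(real n - \<beta>) powr (real k + \<alpha> + 1) / Gamma (real k + \<alpha> + 1) *
      (LBINT t:{0..}. t ^ r * t powr (real k + \<alpha>) * exp (- ((real n - \<beta>) * t))) =
      pochhammer (real k + \<alpha> + 1) r / (real n - \<beta>) ^ r"
    using int unfolding c_def s_def by simp
qed

text \<open>Ratio test: consecutive terms have absolute ratio (1 + r / (k + a)) * \<bar>y\<bar> / (k
  + 1), which tends to 0.\<close>

lemma summable_pochhammer_exp_series:
  fixes a y :: real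
  assumes "a > 0"
  shows "summable (\<lambda>k. pochhammer (real k + a) r / fact k * y ^ k)"
proof -
  \<comment> \<open>Since 1 + r / (k + a) \<le> 1 + r / a, the ratio is at most 1/2 from this index
    on.\<close>
  define N where "N = nat \<lceil>2 * (1 + real r / a) * \<bar>y\<bar>\<rceil>"
  show ?thesis
  proof (rule summable_ratio_test[where c = "1/2" and N = N])
    fix k assume "k \<ge> N"
    have p: "pochhammer (real k + a) r > 0"
      using assms by (intro pochhammer_pos) auto
    \<comment> \<open>Both sides are \<open>pochhammer (real k + a) (Suc r)\<close>, with the first
      factor split off on the left and the last one on the right.\<close>
    have "(real k + a) * pochhammer (real k + a + 1) r = (real k + a + real r) * pochhammer (real k + a) r"
      using pochhammer_rec[of "real k + a" r] pochhammer_rec'[of "real k + a" r] by simp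
    then have "pochhammer (real k + a + 1) r = (1 + real r / (real k + a)) * pochhammer (real k + a) r"
      using assms by (simp add: field_simps add_pos_nonneg)
    also have "\<dots> \<le> (1 + real r / a) * pochhammer (real k + a) r"
      using assms p by (intro mult_right_mono add_left_mono divide_left_mono) auto
    finally have le: "pochhammer (real k + a + 1) r \<le> (1 + real r / a) * pochhammer (real k + a) r" .
    have p': "pochhammer (real k + a + 1) r > 0"
      using assms by (intro pochhammer_pos) auto
    have "2 * (1 + real r / a) * \<bar>y\<bar> \<le> real (Suc k)"
      using \<open>k \<ge> N\<close> unfolding N_def by linarith
    then have small: "(1 + real r / a) * \<bar>y\<bar> / real (Suc k) \<le> 1/2"
      by (simp add: field_simps)
    have "norm (pochhammer (real (Suc k) + a) r / fact (Suc k) * y ^ Suc k) =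
        pochhammer (real k + a + 1) r * (\<bar>y\<bar> / real (Suc k) * (\<bar>y\<bar> ^ k / fact k))"
      using p' by (simp add: abs_mult power_abs add_ac)
    also have "\<dots> \<le> (1 + real r / a) * pochhammer (real k + a) r *
        (\<bar>y\<bar> / real (Suc k) * (\<bar>y\<bar> ^ k / fact k))"
      by (intro mult_right_mono le) auto
    also have "\<dots> = ((1 + real r / a) * \<bar>y\<bar> / real (Suc k)) *
        (pochhammer (real k + a) r * \<bar>y\<bar> ^ k / fact k)"
      by simp
    also have "\<dots> \<le> 1/2 * (pochhammer (real k + a) r * \<bar>y\<bar> ^ k / fact k)"
      using p by (intro mult_right_mono small) auto
    also have "\<dots> = 1/2 * norm (pochhammer (real k + a) r / fact k * y ^ k)"
      using p by (simp add: abs_mult power_abs)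
    finally show "norm (pochhammer (real (Suc k) + a) r / fact (Suc k) * y ^ Suc k)
        \<le> 1/2 * norm (pochhammer (real k + a) r / fact k * y ^ k)" .
  qed simp
qed

text \<open>The series is A(nx) exp(-nx), where A is the exponential generating function of
  \<open>a\<close>. Its derivative B generates the shifted sequence, so the product and chain rules
  give n (B(nx) - A(nx)) exp(-nx). Summability at every y makes A entire, so termwise
  differentiation is valid everywhere.\<close>

lemma has_real_derivative_psi_series:
  fixes a :: "nat \<Rightarrow> real"
  assumes sm: "\<And>y. summable (\<lambda>k. a k / fact k * y ^ k)"
  shows "((\<lambda>x. \<Sum>k. a k * psi n k x) has_real_derivative
    real n * (\<Sum>k. (a (Suc k) - a k) * psi n k x)) (at x)"
proof -
  define A where "A = (\<lambda>y. \<Sum>k. a k / fact k * y ^ k)"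
  define B where "B = (\<lambda>y. \<Sum>k. a (Suc k) / fact k * y ^ k)"
  \<comment> \<open>The factor k + 1 from differentiation cancels against
    \<open>fact (Suc k)\<close>, leaving a pure index shift.\<close>
  have diffs: "diffs (\<lambda>k. a k / fact k) = (\<lambda>k. a (Suc k) / fact k)"
    by (simp add: fun_eq_iff diffs_def del: of_nat_Suc)
  have smB: "summable (\<lambda>k. a (Suc k) / fact k * y ^ k)" for y
    using termdiff_converges_all[OF sm, of y] by (simp add: diffs)
  have A: "(A has_real_derivative B y) (at y)" for y
    using termdiffs_strong_converges_everywhere[OF sm, of y] by (simp add: A_def B_def diffs)
  have A_psi: "(\<Sum>k. a k * psi n k x) = A (real n * x) * exp (- (real n * x))" for x
    unfolding A_def suminf_mult2[OF sm] by (simp add: psi_def mult_ac)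
  have "(\<Sum>k. (a (Suc k) - a k) * psi n k x) =
      (\<Sum>k. (a (Suc k) / fact k * (real n * x) ^ k - a k / fact k * (real n * x) ^ k) *
        exp (- (real n * x)))"
    by (simp add: psi_def divide_simps algebra_simps)
  also have "\<dots> = (B (real n * x) - A (real n * x)) * exp (- (real n * x))"
    unfolding A_def B_def suminf_diff[OF smB sm]
    by (rule suminf_mult2[symmetric]) (intro summable_diff smB sm)
  finally have BA: "(\<Sum>k. (a (Suc k) - a k) * psi n k x) =
      (B (real n * x) - A (real n * x)) * exp (- (real n * x))" .
  show ?thesis
    unfolding A_psi BA
    by (auto intro!: derivative_eq_intros DERIV_chain2[OF A] simp: algebra_simps)
qed

text \<open>Both terms share the factor \<open>pochhammer (z + 1) m\<close>; the remaining factors z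
  + 1 + m and z differ by m + 1.\<close>

lemma pochhammer_diff:
  fixes z :: "'a :: comm_ring_1"
  shows "pochhammer (z + 1) (Suc m) - pochhammer z (Suc m) = of_nat (Suc m) * pochhammer (z + 1) m"
  unfolding pochhammer_rec[of z] pochhammer_rec'[of "z + 1"] by (simp add: algebra_simps)

theorem mainTheorem2:
  fixes \<alpha> \<beta> x :: real and n r :: nat
  assumes "\<alpha> > -1" and "\<beta> > 0" and "n > 0" and "real n > \<beta>"
    and "r \<ge> 1" and "x \<ge> 0"
  shows "(moment \<alpha> \<beta> n r has_real_derivative
            real n * real r / (real n - \<beta>) * moment (\<alpha> + 1) \<beta> n (r - 1) x) (at x within {0..})"
proof -
  define c where "c = real n - \<beta>"
  define a where "a = (\<lambda>k. pochhammer (real k + \<alpha> + 1) r / c ^ r)"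
  define b where "b = (\<lambda>k. pochhammer (real k + (\<alpha> + 1) + 1) (r - 1) / c ^ (r - 1))"
  have c: "c > 0"
    using assms by (simp add: c_def)
  obtain m where m: "r = Suc m"
    using assms(5) by (cases r) auto
  have smp: "summable (\<lambda>k. pochhammer (real k + s + 1) q / d / fact k * y ^ k)"
    if "s > -1" for s q d y
    using summable_divide[OF summable_pochhammer_exp_series[of "s + 1" q y], of d] that
    by (simp add: add_ac mult_ac)
  \<comment> \<open>The difference has degree r - 1 while the denominator is still c^r, so one
    factor 1 / c remains. The argument shifted by 1 is what turns \<alpha> into \<alpha> + 1 in
    \<open>b\<close>.\<close>
  have diff: "a (Suc k) - a k = real r / c * b k" for k
    using pochhammer_diff[of "real k + \<alpha> + 1" m]
    by (simp add: a_def b_def m add_ac flip: diff_divide_distrib)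
  have sm_psi: "summable (\<lambda>k. b k * psi n k x)"
    using summable_mult2[OF smp[of "\<alpha> + 1" "r - 1" "c ^ (r - 1)" "real n * x"],
        of "exp (- (real n * x))"] assms(1)
    by (simp add: b_def psi_def mult_ac)
  have "((\<lambda>x. \<Sum>k. a k * psi n k x) has_real_derivative
      real n * (\<Sum>k. (a (Suc k) - a k) * psi n k x)) (at x)"
    unfolding a_def by (intro has_real_derivative_psi_series smp assms(1))
  \<comment> \<open>The series form of the moment holds at every real point, so the functions are
    equal and the two-sided derivative carries over; it is restricted to \<open>{0..}\<close> only
    at the end.\<close>
  also have "(\<lambda>x. \<Sum>k. a k * psi n k x) = moment \<alpha> \<beta> n r"
    using assms by (simp add: fun_eq_iff moment_eq_pochhammer_series a_def c_def)
  also have "(\<Sum>k. (a (Suc k) - a k) * psi n k x) = real r / c * (\<Sum>k. b k * psi n k x)"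
    unfolding diff suminf_mult[OF sm_psi, symmetric] by (simp add: mult_ac)
  also have "(\<Sum>k. b k * psi n k x) = moment (\<alpha> + 1) \<beta> n (r - 1) x"
    using assms by (simp add: moment_eq_pochhammer_series b_def c_def)
  finally show ?thesis
    by (simp add: c_def has_field_derivative_at_within mult.assoc)
qed

end
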